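(* For every real $x$ with $0<|x|<1$, $$\int_0^\pi \frac{\theta \sin^3 \theta}{1-x^2\cos^2 \theta}\,d\theta=\frac{\pi}{x^2}\left[1+\frac{x^2-1}{x}\tanh^{-1} x\right].$$
   Context: $\tanh^{-1}x=\frac12\ln\frac{1+x}{1-x}$ for $|x|<1$. *)

theory Defs
  imports "HOL-Analysis.Analysis"
begin

end

theory Submission
  imports Defs
begin

text \<open>The factor \<open>g \<theta> = sin\<^sup>3 \<theta> / (1 - x\<^sup>2 cos\<^sup>2 \<theta>)\<close> is invariant under
  \<open>\<theta> \<mapsto> \<pi> - \<theta>\<close>, so averaging the integral with its reflection replaces the weight \<open>\<theta>\<close> by
  \<open>\<pi>/2\<close>. The remaining integral of \<open>g\<close> is elementary: in the variable \<open>u = cos \<theta>\<close> the integrand is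
  \<open>(1 - u\<^sup>2) / (1 - x\<^sup>2 u\<^sup>2) = 1/x\<^sup>2 + (1 - 1/x\<^sup>2) / (1 - x\<^sup>2 u\<^sup>2)\<close>.\<close>

lemma has_integral_reflect_interval:
  fixes f :: "real \<Rightarrow> 'a::real_normed_vector"
  assumes "(f has_integral I) {a..b}"
  shows "((\<lambda>t. f (a + b - t)) has_integral I) {a..b}"
proof -
  have "((\<lambda>t. f (- t + (a + b))) has_integral I)
          ((\<lambda>t. - t + (a + b)) ` {a..b})"
    \<comment> \<open>The substitution has slope -1, so its scaling factor is
      \<open>\<bar>-1\<bar> = 1\<close> and the value \<open>I\<close> is unchanged.\<close>
    using has_integral_affinity[of f I a b "-1" "a + b"] assms
    by (simp add: algebra_simps)
  moreover have "(\<lambda>t. - t + (a + b)) ` {a..b} = {a..b}"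
    by (auto simp: image_iff intro: bexI[where x = "a + b - _"])
  ultimately show ?thesis
    by (simp add: algebra_simps)
qed

lemma has_integral_symmetric_weight:
  fixes g :: "real \<Rightarrow> real"
  assumes g: "(g has_integral J) {a..b}"
    and int: "(\<lambda>t. t * g t) integrable_on {a..b}"
    and sym: "\<And>t. g (a + b - t) = g t"
  shows "((\<lambda>t. t * g t) has_integral (a + b) / 2 * J) {a..b}"
proof -
  obtain I where I: "((\<lambda>t. t * g t) has_integral I) {a..b}"
    using int by blast
  have "((\<lambda>t. (a + b - t) * g t) has_integral I) {a..b}"
    using has_integral_reflect_interval[OF I] by (simp add: sym)
  \<comment> \<open>The weights \<open>t\<close> and \<open>a + b - t\<close> add up to a constant,
    which leaves a multiple of the integral of \<open>g\<close>.\<close>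
  from has_integral_add[OF I this]
  have "((\<lambda>t. (a + b) * g t) has_integral (I + I)) {a..b}"
    by (simp add: algebra_simps)
  moreover have "((\<lambda>t. (a + b) * g t) has_integral (a + b) * J) {a..b}"
    using g by (rule has_integral_mult_right)
  ultimately have "I + I = (a + b) * J"
    by (rule has_integral_unique)
  then have "I = (a + b) / 2 * J"
    by simp
  with I show ?thesis by simp
qed

lemma has_integral_sin_cubed_over:
  fixes x :: real
  assumes "x \<noteq> 0" and "\<bar>x\<bar> < 1"
  shows "((\<lambda>t. sin t ^ 3 / (1 - x\<^sup>2 * (cos t)\<^sup>2)) has_integral
           2 / x\<^sup>2 * (1 + (x\<^sup>2 - 1) / x * artanh x)) {0..pi}"
proof -
  \<comment> \<open>Termwise integration of the decomposition in \<open>u\<close>: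
    \<open>1 / (1 - x\<^sup>2 * u\<^sup>2)\<close> has antiderivative
    \<open>artanh (x * u) / x\<close>, and both signs flip because
    \<open>du = - sin t dt\<close>.\<close>
  define G where "G t = - cos t / x\<^sup>2 - (x\<^sup>2 - 1) / x ^ 3 * artanh (x * cos t)" for t
  \<comment> \<open>This keeps the argument inside the open interval where \<open>artanh\<close> is
    differentiable, endpoints \<open>t = 0\<close> and \<open>t = pi\<close> included.\<close>
  have bound: "\<bar>x * cos t\<bar> < 1" for t
    using mult_left_mono[OF abs_cos_le_one[of t], of "\<bar>x\<bar>"] assms(2) by (simp add: abs_mult)
  have deriv: "(G has_real_derivative sin t ^ 3 / (1 - x\<^sup>2 * (cos t)\<^sup>2)) (at t)" for t
  proof -
    have "(x * cos t)\<^sup>2 < 1"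
      using bound[of t] by (simp add: abs_square_less_1)
    then have nz: "1 - x\<^sup>2 * (cos t)\<^sup>2 \<noteq> 0"
      by (simp add: power_mult_distrib)
    have "((\<lambda>t. artanh (x * cos t)) has_real_derivative
            1 / (1 - (x * cos t)\<^sup>2) * (x * - sin t)) (at t)"
      by (rule DERIV_chain2[where f = artanh])
         (auto intro!: derivative_eq_intros artanh_real_has_field_derivative bound)
    from DERIV_diff[OF DERIV_cdivide[OF DERIV_minus[OF DERIV_cos]] DERIV_cmult[OF this],
        of "x\<^sup>2" "(x\<^sup>2 - 1) / x ^ 3"]
    have "(G has_real_derivative
            sin t / x\<^sup>2 + (x\<^sup>2 - 1) / x ^ 3 * (x * sin t / (1 - x\<^sup>2 * (cos t)\<^sup>2))) (at t)"
      unfolding G_def by (simp add: power_mult_distrib)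
    also have "sin t / x\<^sup>2 + (x\<^sup>2 - 1) / x ^ 3 * (x * sin t / (1 - x\<^sup>2 * (cos t)\<^sup>2))
        = sin t * (1 - (cos t)\<^sup>2) / (1 - x\<^sup>2 * (cos t)\<^sup>2)"
      using assms(1) nz
      by (simp add: divide_simps) (simp add: algebra_simps eval_nat_numeral)
    also have "sin t * (1 - (cos t)\<^sup>2) = sin t ^ 3"
      unfolding sin_squared_eq[symmetric] by (simp add: power2_eq_square power3_eq_cube)
    finally show ?thesis .
  qed
  have "((\<lambda>t. sin t ^ 3 / (1 - x\<^sup>2 * (cos t)\<^sup>2)) has_integral G pi - G 0) {0..pi}"
    by (rule fundamental_theorem_of_calculus)
       (auto intro: has_field_derivative_at_within[OF deriv]
             simp flip: has_real_derivative_iff_has_vector_derivative)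
  \<comment> \<open>Since \<open>artanh\<close> is odd, \<open>G pi = - G 0\<close>; hence the
    factor 2.\<close>
  moreover have "G pi - G 0 = 2 / x\<^sup>2 * (1 + (x\<^sup>2 - 1) / x * artanh x)"
    using assms by (simp add: G_def artanh_minus_real field_simps power2_eq_square power3_eq_cube)
  ultimately show ?thesis by simp
qed

theorem mainTheorem3:
  fixes x :: real
  assumes "0 < \<bar>x\<bar>" and "\<bar>x\<bar> < 1"
  shows "((\<lambda>\<theta>::real. \<theta> * sin \<theta> ^ 3 / (1 - x\<^sup>2 * (cos \<theta>)\<^sup>2)) has_integral
           (pi / x\<^sup>2 * (1 + (x\<^sup>2 - 1) / x * artanh x))) {0..pi}"
proof -
  let ?g = "\<lambda>t. sin t ^ 3 / (1 - x\<^sup>2 * (cos t)\<^sup>2)"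
  \<comment> \<open>A nonvanishing denominator makes the weighted integrand continuous, hence
    integrable.\<close>
  have "1 - x\<^sup>2 * (cos t)\<^sup>2 \<noteq> 0" for t
  proof -
    have "x\<^sup>2 * (cos t)\<^sup>2 \<le> x\<^sup>2 * 1"
      by (intro mult_left_mono) (auto simp: abs_square_le_1)
    moreover have "x\<^sup>2 < 1"
      using assms(2) by (simp add: abs_square_less_1)
    ultimately show ?thesis by linarith
  qed
  then have "(\<lambda>t. t * ?g t) integrable_on {0..pi}"
    by (intro integrable_continuous_real continuous_intros) auto
  \<comment> \<open>The symmetry holds as \<open>cos (pi - t) = - cos t\<close> enters only squared;
    \<open>(0 + pi) / 2\<close> is the midpoint factor in the form the rule produces.\<close>
  then have "((\<lambda>t. t * ?g t) has_integral
      (0 + pi) / 2 * (2 / x\<^sup>2 * (1 + (x\<^sup>2 - 1) / x * artanh x))) {0..pi}"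
    using assms by (intro has_integral_symmetric_weight has_integral_sin_cubed_over) auto
  moreover have "(0 + pi) / 2 * (2 / x\<^sup>2 * (1 + (x\<^sup>2 - 1) / x * artanh x))
      = pi / x\<^sup>2 * (1 + (x\<^sup>2 - 1) / x * artanh x)"
    by (simp only: add_0 mult.assoc[symmetric]) simp
  ultimately show ?thesis by simp
qed

end
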